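(* Let $\omega$ be a majorant, let $M>0$ be a constant, and let $f$ be a harmonic mapping in $\mathbb{D}$ such that $$\Lambda_f(z)\le M\,\omega\left(\frac{1}{1-|z|}\right)\qquad\text{for all }z\in\mathbb{D}.$$ For $r\in(0,1)$ let $\psi_r(\theta)=f(re^{i\theta})$, $\theta\in[0,2\pi)$. Then for every $r\in(0,1)$, $$\|\psi_r\|_{BMO_h}\le2\sqrt{\omega(1)}\,M\,r\,\sqrt{\int_0^1\omega\left(\frac{1}{1-rt}\right)dt}.$$
   Context: $\mathbb{D}$ is the open unit disk in $\mathbb{C}$. A harmonic mapping in $\mathbb{D}$ is a complex-valued function whose real and imaginary parts are harmonic, and $\Lambda_f=|f_z|+|f_{\overline z}|$. A majorant is a continuous increasing function $\omega:[0,\infty)\to[0,\infty)$ with $\omega(0)=0$ such that $\omega(t)/t$ is non-increasing for $t>0$. For a complex-valued $2\pi$-periodic function $\psi\in L^2(0,2\pi)$ (also regarded as a function of $e^{i\theta}$, so $\psi(e^{i\theta})=\psi(\theta)$), define $$\|\psi\|_{BMO_h}=\sup_{z\in\mathbb{D}}\left\{\frac1{2\pi}\int_0^{2\pi}|\psi(\theta)-f_\psi(z)|^2P(e^{i\theta},z)\,d\theta\right\}^{1/2},$$ where $P(e^{i\theta},z)=\frac{1-|z|^2}{|e^{i\theta}-z|^2}$ is the Poisson kernel and $f_\psi(z)=\frac1{2\pi}\int_0^{2\pi}P(e^{i\theta},z)\psi(\theta)\,d\theta$. *)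

theory Defs
  imports "HOL-Analysis.Analysis"
begin

definition partial_deriv :: "complex \<Rightarrow> (complex \<Rightarrow> 'b::real_normed_vector) \<Rightarrow> complex \<Rightarrow> 'b" where
  "partial_deriv v f z = frechet_derivative f (at z) v"

abbreviation partial_x :: "(complex \<Rightarrow> 'b::real_normed_vector) \<Rightarrow> complex \<Rightarrow> 'b" where
  "partial_x \<equiv> partial_deriv 1"

abbreviation partial_y :: "(complex \<Rightarrow> 'b::real_normed_vector) \<Rightarrow> complex \<Rightarrow> 'b" where
  "partial_y \<equiv> partial_deriv \<i>"

(* On an open set, the conditions below say exactly that u is twice continuously differentiable.
   Differentiability is real (Frechet) differentiability. *)
definition C2_on :: "(complex \<Rightarrow> real) \<Rightarrow> complex set \<Rightarrow> bool" where
  "C2_on u S \<longleftrightarrow> u differentiable_on S \<and>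
     (\<forall>v\<in>{1, \<i>}. partial_deriv v u differentiable_on S \<and>
        (\<forall>w\<in>{1, \<i>}. continuous_on S (partial_deriv w (partial_deriv v u))))"

(* Meant for open S. *)
definition harmonic_on :: "(complex \<Rightarrow> real) \<Rightarrow> complex set \<Rightarrow> bool" where
  "harmonic_on u S \<longleftrightarrow> C2_on u S \<and>
     (\<forall>z\<in>S. partial_x (partial_x u) z + partial_y (partial_y u) z = 0)"

definition harmonic_mapping_on :: "(complex \<Rightarrow> complex) \<Rightarrow> complex set \<Rightarrow> bool" where
  "harmonic_mapping_on f S \<longleftrightarrow>
     harmonic_on (\<lambda>z. Re (f z)) S \<and> harmonic_on (\<lambda>z. Im (f z)) S"

definition deriv_z :: "(complex \<Rightarrow> complex) \<Rightarrow> complex \<Rightarrow> complex" where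
  "deriv_z f z = (partial_x f z - \<i> * partial_y f z) / 2"

definition deriv_zbar :: "(complex \<Rightarrow> complex) \<Rightarrow> complex \<Rightarrow> complex" where
  "deriv_zbar f z = (partial_x f z + \<i> * partial_y f z) / 2"

definition Lambda :: "(complex \<Rightarrow> complex) \<Rightarrow> complex \<Rightarrow> real" where
  "Lambda f z = cmod (deriv_z f z) + cmod (deriv_zbar f z)"

(* "Increasing" is not required to be strict, which includes the strictly increasing case.
   Only the values on {0..} matter. *)
definition majorant :: "(real \<Rightarrow> real) \<Rightarrow> bool" where
  "majorant \<omega> \<longleftrightarrow> continuous_on {0..} \<omega> \<and> mono_on {0..} \<omega> \<and> \<omega> ` {0..} \<subseteq> {0..} \<and>
     \<omega> 0 = 0 \<and> antimono_on {0<..} (\<lambda>t. \<omega> t / t)"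

definition poisson_kernel :: "complex \<Rightarrow> complex \<Rightarrow> real" where
  "poisson_kernel \<zeta> z = (1 - (cmod z)\<^sup>2) / (cmod (\<zeta> - z))\<^sup>2"

definition poisson_extension :: "(real \<Rightarrow> complex) \<Rightarrow> complex \<Rightarrow> complex" where
  "poisson_extension \<psi> z =
     (1 / (2 * pi)) *\<^sub>R (LINT \<theta>:{0..2*pi}|lebesgue. poisson_kernel (cis \<theta>) z *\<^sub>R \<psi> \<theta>)"

definition periodic_L2 :: "(real \<Rightarrow> complex) set" where
  "periodic_L2 = {\<psi>. (\<forall>\<theta>. \<psi> (\<theta> + 2 * pi) = \<psi> \<theta>) \<and>
     set_borel_measurable lebesgue {0..2*pi} \<psi> \<and>
     set_integrable lebesgue {0..2*pi} (\<lambda>\<theta>. (cmod (\<psi> \<theta>))\<^sup>2)}"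

(* The supremum may be infinite, hence the extended values. For functions that are not 2pi-periodic
   and square integrable the norm is set to infinity, so that a finite bound
   never rests on the default value 0 of an undefined integral. *)
definition bmo_h_norm :: "(real \<Rightarrow> complex) \<Rightarrow> ennreal" where
  "bmo_h_norm \<psi> =
     (if \<psi> \<in> periodic_L2 then
        (SUP z\<in>ball 0 1. ennreal (sqrt (1 / (2 * pi) *
           (LINT \<theta>:{0..2*pi}|lebesgue.
              (cmod (\<psi> \<theta> - poisson_extension \<psi> z))\<^sup>2 * poisson_kernel (cis \<theta>) z))))
      else \<infinity>)"

end

theory Submission
  imports Defs "HOL-Complex_Analysis.Cauchy_Integral_Formula"
begin

text \<open>Put \<open>F z = f (r z)\<close> and fix \<open>c = F z\<^sub>0\<close>. The Laplacian of \<open>|F - c|\<^sup>2\<close> is at most \<open>4 r\<^sup>2 \<Lambda>\<^sup>2\<close>, with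
  \<open>\<Lambda>\<close> taken at \<open>r z\<close>, hence by \<open>\<omega> T \<le> \<omega> 1 * T\<close> for \<open>T \<ge> 1\<close> at most \<open>h |z|\<close>, where
  \<open>h s = 4 r\<^sup>2 M\<^sup>2 \<omega>(1) \<omega>(1/(1-rs)) / (1-rs)\<close>. For a radial \<open>V\<close> whose Laplacian dominates \<open>h\<close> the
  function \<open>|F - c|\<^sup>2 - V\<close> is superharmonic, so it lies above its Poisson integral, and at \<open>z\<^sub>0\<close> this
  bounds the Poisson integral of \<open>|F - c|\<^sup>2\<close> by \<open>V 1 - V |z\<^sub>0| \<le> V 1 - V 0\<close>.
  The choice \<open>V'' = h\<close>, \<open>V' 0 = 0\<close> gives \<open>V 1 - V 0 = \<integral> (1 - s) h s ds\<close> over \<open>[0, 1]\<close>, and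
  \<open>1 - s \<le> 1 - r s\<close> cancels the denominator of \<open>h\<close>.\<close>

section \<open>Pointwise Laplacians and the minimum principle\<close>

text \<open>Only second derivatives along the two coordinate lines through a point enter; no continuity is
  required of them.\<close>

definition has_second_deriv :: "(real \<Rightarrow> real) \<Rightarrow> (real \<Rightarrow> real) \<Rightarrow> real \<Rightarrow> bool" where
  "has_second_deriv g g' c \<longleftrightarrow>
     (\<forall>\<^sub>F t in nhds 0. (g has_real_derivative g' t) (at t)) \<and> (g' has_real_derivative c) (at 0)"

definition has_laplacian :: "(complex \<Rightarrow> real) \<Rightarrow> real \<Rightarrow> complex \<Rightarrow> bool" where
  "has_laplacian u L z \<longleftrightarrow> (\<exists>p q a b. has_second_deriv (\<lambda>t. u (z + of_real t)) p a \<and>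
     has_second_deriv (\<lambda>t. u (z + \<i> * of_real t)) q b \<and> L = a + b)"

lemma has_laplacianI:
  assumes "has_second_deriv (\<lambda>t. u (z + of_real t)) p a"
    and "has_second_deriv (\<lambda>t. u (z + \<i> * of_real t)) q b" and "L = a + b"
  shows "has_laplacian u L z"
  using assms unfolding has_laplacian_def by blast

lemma has_second_deriv_add:
  assumes "has_second_deriv f f' a" "has_second_deriv g g' b"
  shows "has_second_deriv (\<lambda>t. f t + g t) (\<lambda>t. f' t + g' t) (a + b)"
  using assms eventually_conj[of "\<lambda>t. (f has_real_derivative f' t) (at t)" "nhds 0"
      "\<lambda>t. (g has_real_derivative g' t) (at t)"]
  unfolding has_second_deriv_def
  by (auto elim!: eventually_mono intro!: DERIV_add)

lemma has_second_deriv_cmult: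
  assumes "has_second_deriv f f' a"
  shows "has_second_deriv (\<lambda>t. c * f t) (\<lambda>t. c * f' t) (c * a)"
  using assms unfolding has_second_deriv_def
  by (auto elim!: eventually_mono intro!: derivative_eq_intros)

lemma has_second_deriv_power2:
  assumes "has_second_deriv f f' a"
  shows "has_second_deriv (\<lambda>t. (f t)\<^sup>2) (\<lambda>t. 2 * f t * f' t) (2 * ((f' 0)\<^sup>2 + f 0 * a))"
proof -
  have "(f has_real_derivative f' 0) (at 0)"
    using assms unfolding has_second_deriv_def by (meson eventually_nhds_x_imp_x)
  then show ?thesis
    using assms unfolding has_second_deriv_def
    by (auto elim!: eventually_mono intro!: derivative_eq_intros simp: power2_eq_square algebra_simps)
qed

lemma has_second_deriv_const: "has_second_deriv (\<lambda>t. c) (\<lambda>t. 0) 0"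
  unfolding has_second_deriv_def by auto

lemma has_second_deriv_cong:
  assumes "has_second_deriv f f' a" "\<forall>\<^sub>F t in nhds 0. f t = g t"
  shows "has_second_deriv g f' a"
proof -
  \<comment> \<open>Agreement near 0 is also agreement near every \<open>t\<close> close to 0, and
    the first derivatives at such \<open>t\<close> depend on exactly that.\<close>
  have "\<forall>\<^sub>F t in nhds 0. \<forall>\<^sub>F s in nhds t. f s = g s"
    using assms(2) by (simp add: eventually_eventually)
  moreover have "\<forall>\<^sub>F t in nhds 0. (f has_real_derivative f' t) (at t)"
    using assms(1) unfolding has_second_deriv_def by blast
  ultimately have "\<forall>\<^sub>F t in nhds 0. (g has_real_derivative f' t) (at t)"
    by eventually_elim (simp add: DERIV_cong_ev[OF refl _ refl])
  then show ?thesis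
    using assms(1) unfolding has_second_deriv_def by blast
qed

text \<open>At the minimum \<open>g' 0 = 0\<close>. If \<open>c < 0\<close>, then \<open>g'\<close>
  is negative just to the right of 0, so \<open>g\<close> drops below \<open>g 0\<close>
  there.\<close>

lemma has_second_deriv_min_nonneg:
  assumes "has_second_deriv g g' c" "\<forall>\<^sub>F t in nhds 0. g 0 \<le> g t"
  shows "c \<ge> 0"
proof (rule ccontr)
  assume "\<not> c \<ge> 0"
  then have "c < 0" by simp
  obtain e where e: "e > 0" "\<And>t. \<bar>t\<bar> < e \<Longrightarrow> (g has_real_derivative g' t) (at t) \<and> g 0 \<le> g t"
    using eventually_conj[OF _ assms(2), of "\<lambda>t. (g has_real_derivative g' t) (at t)"] assms(1)
    unfolding has_second_deriv_def eventually_nhds_metric by (auto simp: dist_real_def)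
  have g0: "g' 0 = 0"
    using DERIV_local_min[of g "g' 0" 0 e] e by auto
  have "(g' has_real_derivative c) (at 0)"
    using assms(1) by (simp add: has_second_deriv_def)
  from DERIV_neg_dec_right[OF this \<open>c < 0\<close>] obtain d where d: "d > 0" "\<And>h. 0 < h \<Longrightarrow> h < d \<Longrightarrow> g' h < 0"
    using g0 by auto
  define s where "s = min d e / 2"
  have s: "0 < s" "s < d" "s < e" using d e by (auto simp: s_def)
  have "g s < g 0"
  proof (rule DERIV_neg_imp_decreasing_open[OF s(1)])
    show "\<exists>y. (g has_real_derivative y) (at x) \<and> y < 0" if "0 < x" "x < s" for x
      using e(2)[of x] d(2)[of x] s that by auto
    have "isCont g x" if "x \<in> {0..s}" for x
      using e(2)[of x] s that by (auto intro: DERIV_isCont)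
    then show "continuous_on {0..s} g"
      by (auto intro!: continuous_at_imp_continuous_on)
  qed
  then show False using e(2)[of s] s by auto
qed

section \<open>Algebra and locality of pointwise Laplacians, and the minimum principle\<close>

lemma has_laplacian_add:
  assumes "has_laplacian u K z" "has_laplacian v L z"
  shows "has_laplacian (\<lambda>w. u w + v w) (K + L) z"
proof -
  obtain p q a b where u: "has_second_deriv (\<lambda>t. u (z + of_real t)) p a"
    "has_second_deriv (\<lambda>t. u (z + \<i> * of_real t)) q b" "K = a + b"
    using assms(1) unfolding has_laplacian_def by blast
  obtain p' q' a' b' where v: "has_second_deriv (\<lambda>t. v (z + of_real t)) p' a'"
    "has_second_deriv (\<lambda>t. v (z + \<i> * of_real t)) q' b'" "L = a' + b'"
    using assms(2) unfolding has_laplacian_def by blast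
  show ?thesis
    by (rule has_laplacianI[OF has_second_deriv_add[OF u(1) v(1)] has_second_deriv_add[OF u(2) v(2)]])
       (simp add: u v)
qed

lemma has_laplacian_cmult:
  assumes "has_laplacian u K z"
  shows "has_laplacian (\<lambda>w. c * u w) (c * K) z"
proof -
  obtain p q a b where u: "has_second_deriv (\<lambda>t. u (z + of_real t)) p a"
    "has_second_deriv (\<lambda>t. u (z + \<i> * of_real t)) q b" "K = a + b"
    using assms unfolding has_laplacian_def by blast
  show ?thesis
    by (rule has_laplacianI[OF has_second_deriv_cmult[OF u(1)] has_second_deriv_cmult[OF u(2)]])
       (simp add: u algebra_simps)
qed

lemma has_laplacian_minus: "has_laplacian u K z \<Longrightarrow> has_laplacian (\<lambda>w. - u w) (- K) z"
  using has_laplacian_cmult[of u K z "-1"] by simp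

lemma has_laplacian_diff:
  "has_laplacian u K z \<Longrightarrow> has_laplacian v L z \<Longrightarrow> has_laplacian (\<lambda>w. u w - v w) (K - L) z"
  using has_laplacian_add[OF _ has_laplacian_minus, of u K z v L] by simp

lemma has_laplacian_const: "has_laplacian (\<lambda>w. c) 0 z"
  by (rule has_laplacianI[OF has_second_deriv_const has_second_deriv_const]) simp

lemma eventually_nhds_line:
  assumes "\<forall>\<^sub>F w in nhds (z::complex). P w"
  shows "\<forall>\<^sub>F t::real in nhds 0. P (z + v * of_real t)"
proof -
  have "isCont (\<lambda>t::real. z + v * of_real t) 0"
    by (intro continuous_intros)
  then have "((\<lambda>t::real. z + v * of_real t) \<longlongrightarrow> z) (nhds 0)"
    using tendsto_at_iff_tendsto_nhds[of "\<lambda>t::real. z + v * of_real t" 0] by (simp add: isCont_def)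
  then show ?thesis
    using assms by (simp add: filterlim_iff)
qed

lemma has_laplacian_cong:
  assumes "has_laplacian u K z" "\<forall>\<^sub>F w in nhds z. u w = v w"
  shows "has_laplacian v K z"
proof -
  obtain p q a b where u: "has_second_deriv (\<lambda>t. u (z + of_real t)) p a"
    "has_second_deriv (\<lambda>t. u (z + \<i> * of_real t)) q b" "K = a + b"
    using assms unfolding has_laplacian_def by blast
  have "\<forall>\<^sub>F t in nhds 0. u (z + of_real t) = v (z + of_real t)"
    using eventually_nhds_line[OF assms(2), of 1] by simp
  from has_laplacianI[OF has_second_deriv_cong[OF u(1) this]
      has_second_deriv_cong[OF u(2) eventually_nhds_line[OF assms(2)]]] u(3)
  show ?thesis by simp
qed

lemma has_laplacian_min_nonneg:
  assumes "has_laplacian u L z" "\<forall>\<^sub>F w in nhds z. u z \<le> u w"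
  shows "L \<ge> 0"
proof -
  obtain p q a b where "has_second_deriv (\<lambda>t. u (z + of_real t)) p a"
    "has_second_deriv (\<lambda>t. u (z + \<i> * of_real t)) q b" "L = a + b"
    using assms unfolding has_laplacian_def by blast
  moreover from this have "a \<ge> 0" "b \<ge> 0"
    using eventually_nhds_line[OF assms(2), of 1] eventually_nhds_line[OF assms(2), of \<i>]
    by (auto intro!: has_second_deriv_min_nonneg)
  ultimately show ?thesis by simp
qed

lemma has_second_deriv_shift: "has_second_deriv (\<lambda>t. c + t) (\<lambda>t. 1) 0"
  unfolding has_second_deriv_def by (auto intro!: always_eventually derivative_eq_intros)

lemma has_laplacian_norm_square: "has_laplacian (\<lambda>w. (cmod w)\<^sup>2) 4 z"
proof -
  have "has_second_deriv (\<lambda>t. (Re z + t)\<^sup>2 + (Im z)\<^sup>2) (\<lambda>t. 2 * (Re z + t) * 1 + 0) (2 * (1\<^sup>2 + (Re z + 0) * 0) + 0)"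
    by (intro has_second_deriv_add has_second_deriv_const has_second_deriv_power2 has_second_deriv_shift)
  moreover have "has_second_deriv (\<lambda>t. (Im z + t)\<^sup>2 + (Re z)\<^sup>2) (\<lambda>t. 2 * (Im z + t) * 1 + 0) (2 * (1\<^sup>2 + (Im z + 0) * 0) + 0)"
    by (intro has_second_deriv_add has_second_deriv_const has_second_deriv_power2 has_second_deriv_shift)
  ultimately show ?thesis
    by (intro has_laplacianI) (auto simp: cmod_power2 algebra_simps)
qed

text \<open>Adding \<open>e * (1 - |x|\<^sup>2)\<close> keeps the values on the circle and makes the
  Laplacian at most \<open>- 4 * e\<close>, so the perturbed function has no minimum in the open
  disk.\<close>

lemma superharmonic_minimum_principle:
  assumes cont: "continuous_on (cball 0 1) u"
    and lap: "\<And>z. z \<in> ball 0 1 \<Longrightarrow> \<exists>L\<le>0. has_laplacian u L z"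
    and bdry: "\<And>z. z \<in> sphere 0 1 \<Longrightarrow> u z \<ge> 0"
    and z: "z \<in> cball 0 1"
  shows "u z \<ge> 0"
proof (rule ccontr)
  assume "\<not> u z \<ge> 0"
  \<comment> \<open>Half the depth of the supposed negative value keeps the perturbed function
    negative at \<open>z\<close>.\<close>
  define e where "e = - u z / 2"
  have e: "e > 0" using \<open>\<not> u z \<ge> 0\<close> by (simp add: e_def)
  define w where "w = (\<lambda>x. u x - e * (cmod x)\<^sup>2 + e)"
  have "continuous_on (cball 0 1) w"
    unfolding w_def by (intro continuous_intros cont)
  then obtain x where x: "x \<in> cball 0 1" "\<And>y. y \<in> cball 0 1 \<Longrightarrow> w x \<le> w y"
    using continuous_attains_inf[of "cball (0::complex) 1" w] by auto
  have "w z \<le> u z + e" using e by (simp add: w_def)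
  also have "\<dots> < 0" using e by (simp add: e_def)
  finally have "w x < 0" using x(2)[OF z] by simp
  then have "x \<notin> sphere 0 1"
    using bdry[of x] by (auto simp: w_def)
  then have xb: "x \<in> ball 0 1" using x(1) by auto
  obtain L where L: "L \<le> 0" "has_laplacian u L x" using lap[OF xb] by blast
  have "has_laplacian w (L - e * 4 + 0) x"
    unfolding w_def by (intro has_laplacian_add has_laplacian_diff has_laplacian_cmult
        has_laplacian_const has_laplacian_norm_square L)
  moreover have "\<forall>\<^sub>F y in nhds x. w x \<le> w y"
    using eventually_nhds_in_open[OF open_ball xb] by eventually_elim (use x(2) in auto)
  ultimately have "L - e * 4 + 0 \<ge> 0" by (rule has_laplacian_min_nonneg)
  then show False using L e by simp
qed

section \<open>Poisson integrals\<close>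

definition poisson_integral :: "(complex \<Rightarrow> real) \<Rightarrow> complex \<Rightarrow> real" where
  "poisson_integral g z =
     integral {0..2*pi} (\<lambda>\<theta>. poisson_kernel (cis \<theta>) z * g (cis \<theta>)) / (2 * pi)"

lemma poisson_kernel_nonneg: "cmod z < 1 \<Longrightarrow> poisson_kernel w z \<ge> 0"
  by (simp add: poisson_kernel_def abs_square_le_1)

text \<open>The right-hand side is the real part of the Schwarz kernel, which is holomorphic in
  \<open>z\<close>; this leads to a holomorphic function whose real part is the Poisson
  integral.\<close>

lemma poisson_kernel_eq_Re:
  assumes "cmod w = 1" "cmod z < 1"
  shows "poisson_kernel w z = Re ((w + z) / (w - z))"
proof -
  have "(w + z) / (w - z) = (w + z) * cnj (w - z) / of_real ((cmod (w - z))\<^sup>2)"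
    by (subst complex_div_cnj) simp
  also have "Re \<dots> = Re ((w + z) * cnj (w - z)) / (cmod (w - z))\<^sup>2"
    by (subst Re_divide_of_real) simp
  also have "Re ((w + z) * cnj (w - z)) = (cmod w)\<^sup>2 - (cmod z)\<^sup>2"
    unfolding cmod_power2 by (simp add: algebra_simps power2_eq_square)
  finally show ?thesis using assms by (simp add: poisson_kernel_def)
qed

text \<open>After division by \<open>w\<close> the first term is the Cauchy kernel and the second is
  holomorphic in \<open>w\<close> on the closed disk, so Cauchy's formula and Cauchy's theorem
  integrate them. The identity rests on \<open>cnj w = 1 / w\<close> on the circle.\<close>

lemma poisson_kernel_split:
  assumes "cmod w = 1" "cmod z < 1"
  shows "of_real (poisson_kernel w z) = w / (w - z) + cnj z * w / (1 - cnj z * w)"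
proof -
  have nz: "w - z \<noteq> 0" "w \<noteq> 0" using assms by auto
  have cw: "cnj w = 1 / w"
    using assms nz complex_norm_square[of w] by (simp add: field_simps)
  have "1 - cnj z * w = w * cnj (w - z)"
    using nz by (simp add: cw algebra_simps)
  moreover have "cnj (w - z) \<noteq> 0" using nz by (metis complex_cnj_zero_iff)
  ultimately have 1: "cnj z * w / (1 - cnj z * w) = cnj z / cnj (w - z)"
    using nz by simp
  have "w / (w - z) + cnj z / cnj (w - z) = (w * cnj (w - z) + cnj z * (w - z)) / ((w - z) * cnj (w - z))"
    using nz \<open>cnj (w - z) \<noteq> 0\<close> by (simp add: add_frac_eq mult.commute)
  also have "w * cnj (w - z) + cnj z * (w - z) = of_real ((cmod w)\<^sup>2) - of_real ((cmod z)\<^sup>2)"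
    unfolding complex_norm_square by (simp add: algebra_simps)
  also have "(w - z) * cnj (w - z) = of_real ((cmod (w - z))\<^sup>2)"
    by (simp only: complex_norm_square)
  finally show ?thesis
    unfolding 1 using assms by (simp add: poisson_kernel_def)
qed

text \<open>For \<open>w = cis \<theta>\<close> one has
  \<open>dw = \<i> * cis \<theta> d\<theta>\<close>, which accounts for the factor
  \<open>cis \<theta>\<close> and the division by \<open>\<i>\<close>.\<close>

lemma has_integral_circle:
  assumes "(f has_contour_integral I) (circlepath 0 1)"
  shows "((\<lambda>\<theta>. f (cis \<theta>) * cis \<theta>) has_integral (I / \<i>)) {0..2*pi}"
proof -
  have "((\<lambda>t. f (cis t) * (\<i> * cis t)) has_integral I) {0..2*pi}"
    using assms unfolding circlepath_def
    by (subst (asm) has_contour_integral_part_circlepath_iff) (auto simp: mult.assoc)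
  then have "((\<lambda>t. f (cis t) * (\<i> * cis t) / \<i>) has_integral I / \<i>) {0..2*pi}"
    by (rule has_integral_divide)
  then show ?thesis by (rule has_integral_eq[rotated]) (simp add: algebra_simps)
qed

text \<open>Entire functions are test functions here: later only constants and affine functions are
  inserted.\<close>

lemma poisson_kernel_has_integral_holomorphic:
  fixes q :: "complex \<Rightarrow> complex"
  assumes q: "q holomorphic_on UNIV" and z: "cmod z < 1"
  shows "((\<lambda>\<theta>. complex_of_real (poisson_kernel (cis \<theta>) z) * q (cis \<theta>)) has_integral (2 * pi * q z)) {0..2*pi}"
proof -
  have a: "((\<lambda>u. q u / (u - z)) has_contour_integral (2 * of_real pi * \<i> * q z)) (circlepath 0 1)"
    by (rule Cauchy_integral_circlepath_simple) (use q z in \<open>auto intro: holomorphic_on_subset\<close>)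
  \<comment> \<open>The only possible pole of the second term, the reflected point
    \<open>1 / cnj z\<close>, lies outside the closed disk.\<close>
  have nz: "1 - cnj z * u \<noteq> 0" if "cmod u \<le> 1" for u
  proof
    assume "1 - cnj z * u = 0"
    then have "cmod z * cmod u = 1" by (metis complex_mod_cnj eq_iff_diff_eq_0 norm_mult norm_one)
    moreover have "cmod z * cmod u \<le> cmod z" using that by (simp add: mult_left_le)
    ultimately show False using z by linarith
  qed
  have "(\<lambda>u. cnj z * q u / (1 - cnj z * u)) holomorphic_on cball 0 1"
    using nz by (intro holomorphic_intros holomorphic_on_subset[OF q]) auto
  then have b: "((\<lambda>u. cnj z * q u / (1 - cnj z * u)) has_contour_integral 0) (circlepath 0 1)"
    by (rule Cauchy_theorem_convex_simple) auto
  have "((\<lambda>\<theta>. (q (cis \<theta>) / (cis \<theta> - z) + cnj z * q (cis \<theta>) / (1 - cnj z * cis \<theta>)) * cis \<theta>)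
      has_integral ((2 * of_real pi * \<i> * q z + 0) / \<i>)) {0..2*pi}"
    by (rule has_integral_circle[OF has_contour_integral_add[OF a b]])
  also have "(\<lambda>\<theta>. (q (cis \<theta>) / (cis \<theta> - z) + cnj z * q (cis \<theta>) / (1 - cnj z * cis \<theta>)) * cis \<theta>)
     = (\<lambda>\<theta>. of_real (poisson_kernel (cis \<theta>) z) * q (cis \<theta>))"
    using z by (auto simp: poisson_kernel_split algebra_simps)
  also have "(2 * of_real pi * \<i> * q z + 0) / \<i> = 2 * pi * q z"
    by (simp add: algebra_simps)
  finally show ?thesis .
qed

section \<open>Linearity, monotonicity and boundary behaviour of Poisson integrals\<close>

lemma continuous_on_poisson_kernel:
  assumes "cmod z < 1" shows "continuous_on A (\<lambda>\<theta>. poisson_kernel (cis \<theta>) z)"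
  unfolding poisson_kernel_def using assms by (intro continuous_intros) auto

lemma continuous_on_circle_param:
  assumes "continuous_on (sphere 0 1) g" shows "continuous_on A (\<lambda>\<theta>. g (cis \<theta>))"
  by (rule continuous_on_compose2[OF assms]) (auto intro!: continuous_intros)

lemma poisson_integrand_integrable:
  fixes g :: "complex \<Rightarrow> real"
  assumes "continuous_on (sphere 0 1) g" "cmod z < 1"
  shows "(\<lambda>\<theta>. poisson_kernel (cis \<theta>) z * g (cis \<theta>)) integrable_on {0..2*pi}"
  by (intro integrable_continuous_real continuous_intros continuous_on_poisson_kernel
      continuous_on_circle_param assms)

lemma poisson_integral_Re:
  assumes "q holomorphic_on UNIV" "cmod z < 1"
  shows "poisson_integral (\<lambda>w. Re (q w)) z = Re (q z)"
proof -
  have "((\<lambda>\<theta>. Re (of_real (poisson_kernel (cis \<theta>) z) * q (cis \<theta>))) has_integral Re (2 * pi * q z)) {0..2*pi}"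
    by (rule has_integral_Re[OF poisson_kernel_has_integral_holomorphic[OF assms]])
  then show ?thesis
    unfolding poisson_integral_def by (simp add: integral_unique)
qed

lemma poisson_integral_const: "cmod z < 1 \<Longrightarrow> poisson_integral (\<lambda>w. c) z = c"
  using poisson_integral_Re[of "\<lambda>w. of_real c" z] by simp

lemma poisson_integral_add:
  assumes "continuous_on (sphere 0 1) f" "continuous_on (sphere 0 1) g" "cmod z < 1"
  shows "poisson_integral (\<lambda>w. f w + g w) z = poisson_integral f z + poisson_integral g z"
  unfolding poisson_integral_def
  using integral_add[OF poisson_integrand_integrable[OF assms(1,3)] poisson_integrand_integrable[OF assms(2,3)]]
  by (simp add: distrib_left add_divide_distrib)

lemma poisson_integral_cmult: "poisson_integral (\<lambda>w. c * f w) z = c * poisson_integral f z"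
proof -
  have "(\<lambda>\<theta>. poisson_kernel (cis \<theta>) z * (c * f (cis \<theta>))) = (\<lambda>\<theta>. c * (poisson_kernel (cis \<theta>) z * f (cis \<theta>)))"
    by auto
  then show ?thesis
    unfolding poisson_integral_def by (simp del: mult_cancel_left)
qed

lemma poisson_integral_minus: "poisson_integral (\<lambda>w. - f w) z = - poisson_integral f z"
  using poisson_integral_cmult[of "-1" f z] by simp

lemma poisson_integral_diff:
  assumes "continuous_on (sphere 0 1) f" "continuous_on (sphere 0 1) g" "cmod z < 1"
  shows "poisson_integral (\<lambda>w. f w - g w) z = poisson_integral f z - poisson_integral g z"
  using poisson_integral_add[OF assms(1) continuous_on_minus[OF assms(2)] assms(3)]
  by (simp add: poisson_integral_minus)

lemma poisson_integral_mono:
  assumes "continuous_on (sphere 0 1) f" "continuous_on (sphere 0 1) g" "cmod z < 1"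
    and "\<And>w. cmod w = 1 \<Longrightarrow> f w \<le> g w"
  shows "poisson_integral f z \<le> poisson_integral g z"
  unfolding poisson_integral_def
  by (intro divide_right_mono integral_le poisson_integrand_integrable mult_left_mono
      poisson_kernel_nonneg assms) auto

lemma poisson_integral_cong:
  assumes "\<And>w. cmod w = 1 \<Longrightarrow> f w = g w"
  shows "poisson_integral f z = poisson_integral g z"
  unfolding poisson_integral_def using assms by simp

text \<open>On the circle the squared distance is the real part of the affine function
  \<open>2 - 2 * cnj a * w\<close>, so its Poisson integral is the value of that real part at
  \<open>z\<close>.\<close>

lemma poisson_integral_norm_square_dist:
  assumes "cmod z < 1" "cmod a = 1"
  shows "poisson_integral (\<lambda>w. (cmod (w - a))\<^sup>2) z \<le> 2 * cmod (z - a)"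
proof -
  have sq: "(cmod (w - a))\<^sup>2 = Re (2 - 2 * cnj a * w)" if "cmod w = 1" for w
  proof -
    have "(cmod (w - a))\<^sup>2 = (cmod w)\<^sup>2 + (cmod a)\<^sup>2 - Re (2 * cnj a * w)"
      unfolding cmod_power2 by (simp add: power2_eq_square algebra_simps)
    then show ?thesis using that assms by simp
  qed
  have "poisson_integral (\<lambda>w. (cmod (w - a))\<^sup>2) z = poisson_integral (\<lambda>w. Re (2 - 2 * cnj a * w)) z"
    by (rule poisson_integral_cong) (rule sq)
  also have "\<dots> = Re (2 - 2 * cnj a * z)"
    by (rule poisson_integral_Re[OF _ assms(1)]) (intro holomorphic_intros)
  also have "2 - 2 * cnj a * z = 2 * (cnj a * (a - z))"
    using assms complex_norm_square[of a] by (simp add: algebra_simps)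
  also have "Re \<dots> \<le> cmod (2 * (cnj a * (a - z)))" by (rule complex_Re_le_cmod)
  also have "\<dots> = 2 * cmod (z - a)" using assms by (simp add: norm_mult norm_minus_commute)
  finally show ?thesis .
qed

text \<open>Korovkin's argument: a test function with values small near \<open>a\<close> is dominated by
  \<open>e + C |w - a|\<^sup>2\<close>, whose Poisson integral is explicit.\<close>

lemma poisson_integral_tendsto_boundary:
  assumes g: "continuous_on (sphere 0 1) g" and a: "cmod a = 1"
  shows "(poisson_integral g \<longlongrightarrow> g a) (at a within ball 0 1)"
proof (rule tendstoI)
  fix e :: real assume e: "e > 0"
  have "compact (g ` sphere 0 1)" using g by (intro compact_continuous_image) auto
  then obtain B where B: "\<And>w. cmod w = 1 \<Longrightarrow> \<bar>g w\<bar> \<le> B"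
    using compact_imp_bounded[of "g ` sphere 0 1"] unfolding bounded_iff real_norm_def by (metis imageI mem_sphere_0)
  obtain d where d: "d > 0" "\<And>w. cmod w = 1 \<Longrightarrow> cmod (w - a) < d \<Longrightarrow> \<bar>g w - g a\<bar> < e / 2"
    using g a e unfolding continuous_on_iff
    by (metis dist_norm half_gt_zero_iff mem_sphere_0 real_norm_def)
  \<comment> \<open>For \<open>|w - a| >= d\<close> this yields
    \<open>C * |w - a|\<^sup>2 >= 2 * B\<close>, which bounds \<open>|g w - g a|\<close>.\<close>
  define C where "C = 2 * B / d\<^sup>2"
  have "B \<ge> 0" using B[OF a] by linarith
  then have C: "C \<ge> 0" by (simp add: C_def)
  have bd: "\<bar>g w - g a\<bar> \<le> e / 2 + C * (cmod (w - a))\<^sup>2" if w: "cmod w = 1" for w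
  proof (cases "cmod (w - a) < d")
    case True
    then show ?thesis using d(2)[OF w True] C by (simp add: add_increasing2)
  next
    case False
    then have "d\<^sup>2 \<le> (cmod (w - a))\<^sup>2" using d by (simp add: power_mono)
    then have "C * d\<^sup>2 \<le> C * (cmod (w - a))\<^sup>2" using C by (rule mult_left_mono)
    moreover have "C * d\<^sup>2 = 2 * B" using d by (simp add: C_def)
    ultimately show ?thesis using B[OF w] B[OF a] e by linarith
  qed
  have cg: "continuous_on (sphere 0 1) (\<lambda>w. g w - g a)" by (intro continuous_intros g)
  have cs: "continuous_on (sphere 0 1) (\<lambda>w. C * (cmod (w - a))\<^sup>2)" by (intro continuous_intros)
  have ce: "continuous_on (sphere 0 1) (\<lambda>w. e / 2 + C * (cmod (w - a))\<^sup>2)" by (intro continuous_intros)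
  have main: "\<bar>poisson_integral g z - g a\<bar> \<le> e / 2 + C * (2 * cmod (z - a))" if z: "cmod z < 1" for z
  proof -
    have eq: "poisson_integral (\<lambda>w. g w - g a) z = poisson_integral g z - g a"
      using z by (simp add: poisson_integral_diff g poisson_integral_const)
    have "poisson_integral (\<lambda>w. e / 2 + C * (cmod (w - a))\<^sup>2) z
        = e / 2 + C * poisson_integral (\<lambda>w. (cmod (w - a))\<^sup>2) z"
      using poisson_integral_add[OF continuous_on_const cs z, of "e/2"] z
      by (simp add: poisson_integral_const poisson_integral_cmult)
    also have "\<dots> \<le> e / 2 + C * (2 * cmod (z - a))"
      using C poisson_integral_norm_square_dist[OF z a] by (intro add_left_mono mult_left_mono)
    finally have ub: "poisson_integral (\<lambda>w. e / 2 + C * (cmod (w - a))\<^sup>2) z \<le> e / 2 + C * (2 * cmod (z - a))" .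
    have "poisson_integral (\<lambda>w. g w - g a) z \<le> poisson_integral (\<lambda>w. e / 2 + C * (cmod (w - a))\<^sup>2) z"
      by (rule poisson_integral_mono[OF cg ce z]) (use bd in force)
    moreover have "poisson_integral (\<lambda>w. - (g w - g a)) z \<le> poisson_integral (\<lambda>w. e / 2 + C * (cmod (w - a))\<^sup>2) z"
      by (rule poisson_integral_mono[OF continuous_on_minus[OF cg] ce z]) (use bd in force)
    ultimately show ?thesis using ub unfolding poisson_integral_minus eq by linarith
  qed
  have "((\<lambda>z. e / 2 + C * (2 * cmod (z - a))) \<longlongrightarrow> e / 2 + C * (2 * cmod (a - a))) (at a within ball 0 1)"
    by (intro tendsto_intros)
  then have "\<forall>\<^sub>F z in at a within ball 0 1. e / 2 + C * (2 * cmod (z - a)) < e"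
    by (rule order_tendstoD(2)) (use e in auto)
  moreover have "\<forall>\<^sub>F z in at a within ball 0 1. cmod z < 1"
    unfolding eventually_at_filter by (rule always_eventually) auto
  ultimately show "\<forall>\<^sub>F z in at a within ball 0 1. dist (poisson_integral g z) (g a) < e"
  proof eventually_elim
    case (elim z)
    then show ?case using main[of z] by (simp add: dist_real_def)
  qed
qed

section \<open>The Poisson integral as a harmonic function, and comparison with superharmonic
  functions\<close>

lemma has_laplacian_Re_holomorphic:
  assumes H: "H holomorphic_on S" and S: "open S" and z: "z \<in> S"
  shows "has_laplacian (\<lambda>w. Re (H w)) 0 z"
proof -
  have line: "has_second_deriv (\<lambda>t. Re (H (z + v * of_real t))) (\<lambda>t. Re (deriv H (z + v * of_real t) * v))
      (Re (deriv (deriv H) z * v * v))" for v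
  proof -
    have D: "((\<lambda>t. Re (K (z + v * of_real t) * c)) has_real_derivative Re (deriv K (z + v * of_real t) * v * c)) (at t)"
      if K: "K holomorphic_on S" and t: "z + v * of_real t \<in> S" for K c t
    proof -
      have "(K has_field_derivative deriv K (z + v * of_real t)) (at (z + v * of_real t))"
        using K t S by (simp add: holomorphic_derivI)
      moreover have "((\<lambda>t. z + v * of_real t) has_vector_derivative v) (at t)"
        by (auto intro!: derivative_eq_intros)
      ultimately have "((\<lambda>t. K (z + v * of_real t)) has_vector_derivative v * deriv K (z + v * of_real t)) (at t)"
        using field_vector_diff_chain_at by (fastforce simp: o_def)
      then have "((\<lambda>t. K (z + v * of_real t) * c) has_vector_derivative v * deriv K (z + v * of_real t) * c) (at t)"
        by (rule has_vector_derivative_mult_left)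
      then show ?thesis
        using bounded_linear.has_vector_derivative[OF bounded_linear_Re] by (fastforce simp: has_real_derivative_iff_has_vector_derivative mult.commute)
    qed
    have ev: "\<forall>\<^sub>F t in nhds 0. z + v * of_real t \<in> S"
      by (rule eventually_nhds_line) (use eventually_nhds_in_open S z in auto)
    have "\<forall>\<^sub>F t in nhds 0. ((\<lambda>t. Re (H (z + v * of_real t))) has_real_derivative
        Re (deriv H (z + v * of_real t) * v)) (at t)"
      using ev by eventually_elim (use D[OF H, of _ 1] in simp)
    moreover have "((\<lambda>t. Re (deriv H (z + v * of_real t) * v)) has_real_derivative Re (deriv (deriv H) z * v * v)) (at 0)"
      using D[OF holomorphic_deriv[OF H S], of 0 v] z by simp
    ultimately show ?thesis unfolding has_second_deriv_def by blast
  qed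
  \<comment> \<open>The second derivatives in the directions 1 and \<open>\<i>\<close> are opposite
    because \<open>\<i>\<^sup>2 = - 1\<close>.\<close>
  show ?thesis
    by (rule has_laplacianI[OF line[of 1, simplified] line[of \<i>]]) simp
qed

text \<open>The function is the Schwarz integral of \<open>g\<close>; differentiation under the
  integral sign makes it holomorphic.\<close>

lemma poisson_integral_eq_Re_holomorphic:
  assumes g: "continuous_on (sphere 0 1) g"
  obtains H where "H holomorphic_on ball 0 1" "\<And>w. w \<in> ball 0 1 \<Longrightarrow> poisson_integral g w = Re (H w)"
proof -
  define H where "H = (\<lambda>w. integral (cbox 0 (2*pi)) (\<lambda>\<theta>. (cis \<theta> + w) / (cis \<theta> - w) * of_real (g (cis \<theta>))))"
  have cg: "continuous_on A (\<lambda>\<theta>. g (cis \<theta>))" for A by (rule continuous_on_circle_param[OF g])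
  have integrable: "(\<lambda>\<theta>. (cis \<theta> + w) / (cis \<theta> - w) * of_real (g (cis \<theta>))) integrable_on cbox 0 (2*pi)"
    if "w \<in> ball 0 1" for w
    using that by (intro integrable_continuous continuous_intros cg) auto
  have hol: "H holomorphic_on ball 0 1"
    unfolding H_def
  proof (rule leibniz_rule_holomorphic[where fx = "\<lambda>w \<theta>. 2 * cis \<theta> / (cis \<theta> - w)\<^sup>2 * of_real (g (cis \<theta>))"])
    show "((\<lambda>w. (cis \<theta> + w) / (cis \<theta> - w) * of_real (g (cis \<theta>))) has_field_derivative
       2 * cis \<theta> / (cis \<theta> - w)\<^sup>2 * of_real (g (cis \<theta>))) (at w within ball 0 1)"
      if "w \<in> ball 0 1" for w \<theta>
      using that by (auto intro!: derivative_eq_intros simp: power2_eq_square field_simps)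
    have "continuous_on (ball 0 1 \<times> cbox 0 (2*pi)) (\<lambda>x. g (cis (snd x)))"
      by (rule continuous_on_compose2[OF cg[of UNIV]]) (auto intro!: continuous_intros)
    then show "continuous_on (ball 0 1 \<times> cbox 0 (2*pi)) (\<lambda>(w, \<theta>). 2 * cis \<theta> / (cis \<theta> - w)\<^sup>2 * of_real (g (cis \<theta>)))"
      unfolding case_prod_unfold by (intro continuous_intros) auto
  qed (use integrable in auto)
  have eq: "poisson_integral g w = Re (H w / (2*pi))" if "w \<in> ball 0 1" for w
  proof -
    have "Re (H w) = integral (cbox 0 (2*pi)) (\<lambda>\<theta>. Re ((cis \<theta> + w) / (cis \<theta> - w) * of_real (g (cis \<theta>))))"
      unfolding H_def using has_integral_Re[OF integrable_integral[OF integrable[OF that]]]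
      by (simp add: integral_unique)
    also have "(\<lambda>\<theta>. Re ((cis \<theta> + w) / (cis \<theta> - w) * of_real (g (cis \<theta>)))) =
        (\<lambda>\<theta>. poisson_kernel (cis \<theta>) w * g (cis \<theta>))"
    proof
      have Re_mult: "Re (c * of_real x) = Re c * x" for c x by simp
      show "Re ((cis \<theta> + w) / (cis \<theta> - w) * of_real (g (cis \<theta>))) = poisson_kernel (cis \<theta>) w * g (cis \<theta>)" for \<theta>
        unfolding Re_mult using that by (simp add: poisson_kernel_eq_Re)
    qed
    finally show ?thesis by (simp add: poisson_integral_def)
  qed
  show ?thesis
    by (rule that[of "\<lambda>w. H w / (2*pi)", OF _ eq]) (intro holomorphic_intros hol, auto)
qed

lemma has_laplacian_poisson_integral:
  assumes g: "continuous_on (sphere 0 1) g" and z: "z \<in> ball 0 1"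
  shows "has_laplacian (poisson_integral g) 0 z"
proof -
  obtain H where H: "H holomorphic_on ball 0 1" "\<And>w. w \<in> ball 0 1 \<Longrightarrow> poisson_integral g w = Re (H w)"
    using poisson_integral_eq_Re_holomorphic[OF g] by blast
  have "\<forall>\<^sub>F w in nhds z. Re (H w) = poisson_integral g w"
    using eventually_nhds_in_open[OF open_ball z] by eventually_elim (simp add: H)
  with has_laplacian_Re_holomorphic[OF H(1) open_ball z] show ?thesis
    by (rule has_laplacian_cong)
qed

lemma continuous_on_poisson_integral:
  assumes g: "continuous_on (sphere 0 1) g"
  shows "continuous_on (ball 0 1) (poisson_integral g)"
proof -
  obtain H where H: "H holomorphic_on ball 0 1" "\<And>w. w \<in> ball 0 1 \<Longrightarrow> poisson_integral g w = Re (H w)"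
    using poisson_integral_eq_Re_holomorphic[OF g] by blast
  then have "continuous_on (ball 0 1) (\<lambda>w. Re (H w))"
    by (intro continuous_intros holomorphic_on_imp_continuous_on)
  then show ?thesis by (rule continuous_on_eq) (simp add: H(2))
qed

text \<open>The Poisson integral of \<open>u\<close>, continued by \<open>u\<close> itself on the
  circle, is continuous on the closed disk and harmonic inside. Subtracting it from \<open>u\<close>
  leaves a superharmonic function with boundary values 0, to which the minimum principle
  applies.\<close>

lemma poisson_integral_le_superharmonic:
  assumes u: "continuous_on (cball 0 1) u"
    and lap: "\<And>z. z \<in> ball 0 1 \<Longrightarrow> \<exists>L\<le>0. has_laplacian u L z"
    and z: "z \<in> ball 0 1"
  shows "poisson_integral u z \<le> u z"
proof -
  have us: "continuous_on (sphere 0 1) u" using u by (rule continuous_on_subset) auto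
  define k where "k = (\<lambda>w. if w \<in> ball 0 1 then poisson_integral u w else u w)"
  have kP: "\<forall>\<^sub>F w in nhds x. poisson_integral u w = k w" if "x \<in> ball 0 1" for x
    using eventually_nhds_in_open[OF open_ball that] by eventually_elim (simp add: k_def)
  have lk: "has_laplacian k 0 x" if "x \<in> ball 0 1" for x
    using has_laplacian_cong[OF has_laplacian_poisson_integral[OF us] kP[OF that]] that by simp
  have H: "(k \<longlongrightarrow> k a) (at a within cball 0 1)" if a: "a \<in> cball 0 1" for a
  proof (cases "a \<in> ball 0 1")
    case True
    have "isCont (poisson_integral u) a"
      using continuous_on_poisson_integral[OF us] True by (simp add: continuous_on_eq_continuous_at)
    then have "isCont k a" using isCont_cong[OF kP[OF True]] by simp
    then show ?thesis by (meson isCont_def subset_UNIV tendsto_within_subset)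
  next
    \<comment> \<open>At a boundary point the limits from the open disk and along the circle are
      found separately and then united.\<close>
    case False
    then have a1: "cmod a = 1" using a by simp
    have "(poisson_integral u \<longlongrightarrow> k a) (at a within ball 0 1)"
      using poisson_integral_tendsto_boundary[OF us a1] a1 by (simp add: k_def)
    then have "(k \<longlongrightarrow> k a) (at a within ball 0 1)"
      by (rule Lim_transform_eventually) (auto simp: eventually_at_filter k_def)
    moreover have "(u \<longlongrightarrow> k a) (at a within sphere 0 1)"
      using us a1 by (simp add: continuous_on_def k_def)
    then have "(k \<longlongrightarrow> k a) (at a within sphere 0 1)"
      by (rule Lim_transform_eventually) (auto simp: eventually_at_filter k_def)
    ultimately have "(k \<longlongrightarrow> k a) (at a within (ball 0 1 \<union> sphere 0 1))"
      by (simp add: Lim_within_Un)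
    also have "ball 0 1 \<union> sphere 0 1 = cball (0::complex) 1" by auto
    finally show ?thesis .
  qed
  have "0 \<le> u z - k z"
  proof (rule superharmonic_minimum_principle)
    show "continuous_on (cball 0 1) (\<lambda>w. u w - k w)"
      using H by (intro continuous_intros u) (simp add: continuous_on_def)
    show "\<exists>L\<le>0. has_laplacian (\<lambda>w. u w - k w) L x" if "x \<in> ball 0 1" for x
      using has_laplacian_diff[OF _ lk[OF that]] lap[OF that] by fastforce
  qed (use z in \<open>auto simp: k_def\<close>)
  then show ?thesis using z by (simp add: k_def)
qed

section \<open>Radial subsolutions and harmonic functions\<close>

text \<open>Working on the whole line lets a radial profile be differentiated at 0, and the
  normalisation \<open>I 0 = 0\<close> gives it slope 0 there.\<close>

lemma continuous_antiderivative:
  fixes h :: "real \<Rightarrow> real"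
  assumes "continuous_on UNIV h"
  obtains I where "\<And>x. (I has_real_derivative h x) (at x)" "I 0 = 0"
proof -
  have "isCont h x" for x
    using assms by (simp add: continuous_on_eq_continuous_at)
  then obtain I where "\<And>x. (I has_vector_derivative h x) (at x)"
    using einterval_antiderivative[of "-\<infinity>" "\<infinity>" h] by auto
  then have "((\<lambda>x. I x - I 0) has_real_derivative h x) (at x)" for x
    by (auto intro!: derivative_eq_intros simp: has_real_derivative_iff_has_vector_derivative)
  then show ?thesis by (intro that[of "\<lambda>x. I x - I 0"]) auto
qed

text \<open>This is the chain rule away from the origin, where the square root is smooth. It serves
  both coordinate lines, with \<open>x\<close> and \<open>y\<close> interchanged for the
  second.\<close>

lemma has_second_deriv_radial:
  assumes I: "\<And>x. (I has_real_derivative h x) (at x)" and V: "\<And>x. (V has_real_derivative I x) (at x)"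
    and xy: "(x::real) \<noteq> 0 \<or> y \<noteq> 0"
  defines "\<rho> \<equiv> sqrt (x\<^sup>2 + y\<^sup>2)"
  shows "has_second_deriv (\<lambda>t. V (sqrt ((x + t)\<^sup>2 + y\<^sup>2)))
           (\<lambda>t. I (sqrt ((x + t)\<^sup>2 + y\<^sup>2)) * ((x + t) / sqrt ((x + t)\<^sup>2 + y\<^sup>2)))
           (h \<rho> * (x\<^sup>2 / \<rho>\<^sup>2) + I \<rho> * (1 / \<rho> - x\<^sup>2 / \<rho> ^ 3))"
proof -
  have R: "((\<lambda>t. sqrt ((x + t)\<^sup>2 + y\<^sup>2)) has_real_derivative (x + t) / sqrt ((x + t)\<^sup>2 + y\<^sup>2)) (at t)"
    if "(x + t)\<^sup>2 + y\<^sup>2 > 0" for t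
  proof -
    have "((\<lambda>t. (x + t)\<^sup>2 + y\<^sup>2) has_real_derivative 2 * (x + t)) (at t)"
      by (auto intro!: derivative_eq_intros)
    from DERIV_chain2[OF DERIV_real_sqrt[OF that] this] show ?thesis
      by (rule DERIV_cong) (simp only: divide_inverse, simp)
  qed
  have pos: "x\<^sup>2 + y\<^sup>2 > 0" using xy by (simp add: sum_power2_gt_zero_iff)
  have "isCont (\<lambda>t. (x + t)\<^sup>2 + y\<^sup>2) 0" by (intro continuous_intros)
  then have "((\<lambda>t. (x + t)\<^sup>2 + y\<^sup>2) \<longlongrightarrow> x\<^sup>2 + y\<^sup>2) (nhds 0)"
    using tendsto_at_iff_tendsto_nhds[of "\<lambda>t. (x + t)\<^sup>2 + y\<^sup>2" 0] by (simp add: isCont_def)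
  then have "\<forall>\<^sub>F t in nhds 0. (x + t)\<^sup>2 + y\<^sup>2 > 0" using pos by (rule order_tendstoD)
  then have "\<forall>\<^sub>F t in nhds 0. ((\<lambda>t. V (sqrt ((x + t)\<^sup>2 + y\<^sup>2))) has_real_derivative
      I (sqrt ((x + t)\<^sup>2 + y\<^sup>2)) * ((x + t) / sqrt ((x + t)\<^sup>2 + y\<^sup>2))) (at t)"
    by eventually_elim (rule DERIV_chain2[OF V R])
  moreover have "((\<lambda>t. I (sqrt ((x + t)\<^sup>2 + y\<^sup>2)) * ((x + t) / sqrt ((x + t)\<^sup>2 + y\<^sup>2))) has_real_derivative
      (h \<rho> * (x\<^sup>2 / \<rho>\<^sup>2) + I \<rho> * (1 / \<rho> - x\<^sup>2 / \<rho> ^ 3))) (at 0)"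
  proof -
    have \<rho>: "\<rho> > 0" using pos by (simp add: \<rho>_def)
    have R0: "((\<lambda>t. sqrt ((x + t)\<^sup>2 + y\<^sup>2)) has_real_derivative x / \<rho>) (at 0)"
      using R[of 0] pos by (simp add: \<rho>_def)
    have s0: "sqrt ((x + 0)\<^sup>2 + y\<^sup>2) = \<rho>" by (simp add: \<rho>_def)
    have "((\<lambda>t. I (sqrt ((x + t)\<^sup>2 + y\<^sup>2))) has_real_derivative h \<rho> * (x / \<rho>)) (at 0)"
      by (rule DERIV_chain2[OF _ R0]) (use I s0 in simp)
    moreover have "((\<lambda>t. (x + t) / sqrt ((x + t)\<^sup>2 + y\<^sup>2)) has_real_derivative (1 * \<rho> - x * (x / \<rho>)) / (\<rho> * \<rho>)) (at 0)"
    proof -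
      have "((\<lambda>t. x + t) has_real_derivative 1) (at 0)" by (auto intro!: derivative_eq_intros)
      from DERIV_divide[OF this R0, unfolded s0] \<rho> show ?thesis by simp
    qed
    ultimately have "((\<lambda>t. I (sqrt ((x + t)\<^sup>2 + y\<^sup>2)) * ((x + t) / sqrt ((x + t)\<^sup>2 + y\<^sup>2))) has_real_derivative
      h \<rho> * (x / \<rho>) * ((x + 0) / sqrt ((x + 0)\<^sup>2 + y\<^sup>2)) + (1 * \<rho> - x * (x / \<rho>)) / (\<rho> * \<rho>) * I (sqrt ((x + 0)\<^sup>2 + y\<^sup>2))) (at 0)"
      by (rule DERIV_mult)
    moreover have "h \<rho> * (x / \<rho>) * ((x + 0) / sqrt ((x + 0)\<^sup>2 + y\<^sup>2)) + (1 * \<rho> - x * (x / \<rho>)) / (\<rho> * \<rho>) * I (sqrt ((x + 0)\<^sup>2 + y\<^sup>2))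
      = h \<rho> * (x\<^sup>2 / \<rho>\<^sup>2) + I \<rho> * (1 / \<rho> - x\<^sup>2 / \<rho> ^ 3)"
      unfolding s0 using \<rho> by (simp add: field_simps power2_eq_square power3_eq_cube)
    ultimately show ?thesis by simp
  qed
  ultimately show ?thesis unfolding has_second_deriv_def by blast
qed

text \<open>Solving \<open>V'' = h\<close> rather than \<open>V'' + V' / \<rho> = h\<close> makes \<open>V\<close> a subsolution only, but the
  increment \<open>V 1 - V 0\<close> becomes an integral without logarithm.\<close>

lemma radial_subsolution:
  fixes h :: "real \<Rightarrow> real"
  assumes h: "continuous_on UNIV h" and nonneg: "\<And>s. h s \<ge> 0" and even: "\<And>s. h (- s) = h s"
  obtains V where "continuous_on UNIV V" "\<And>s. s \<ge> 0 \<Longrightarrow> V 0 \<le> V s"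
    "\<And>z. \<exists>L. h (cmod z) \<le> L \<and> has_laplacian (\<lambda>w. V (cmod w)) L z"
    "((\<lambda>s. (1 - s) * h s) has_integral (V 1 - V 0)) {0..1}"
proof -
  obtain I where I: "\<And>x. (I has_real_derivative h x) (at x)" "I 0 = 0"
    using continuous_antiderivative[OF h] by blast
  have "continuous_on UNIV I"
    using I(1) by (auto intro!: continuous_at_imp_continuous_on DERIV_isCont)
  then obtain V where V: "\<And>x. (V has_real_derivative I x) (at x)"
    using continuous_antiderivative by blast
  have I_pos: "I s \<ge> 0" if "s \<ge> 0" for s
    using DERIV_nonneg_imp_nondecreasing[OF that, of I] I nonneg by metis
  have V_ge: "V 0 \<le> V s" if "s \<ge> 0" for s
    using DERIV_nonneg_imp_nondecreasing[OF that, of V] V I_pos by metis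
  \<comment> \<open>As \<open>h\<close> is even, \<open>I\<close> is odd and \<open>V\<close> is
    even: on a line through the origin \<open>V |t|\<close> is then simply \<open>V t\<close>, with
    second derivative \<open>h 0\<close> at 0.\<close>
  have "((\<lambda>t. I (- t) + I t) has_real_derivative 0) (at t)" for t
    using DERIV_add[OF I(1)[of "- t", unfolded DERIV_mirror] I(1)[of t]] even[of t] by simp
  then have "I (- t) + I t = I (- 0) + I 0" for t
    using DERIV_isconst_all by blast
  then have odd: "I (- t) = - I t" for t using I(2) by (simp add: eq_neg_iff_add_eq_0)
  have "((\<lambda>t. V (- t) - V t) has_real_derivative 0) (at t)" for t
    using DERIV_diff[OF V[of "- t", unfolded DERIV_mirror] V[of t]] odd[of t] by simp
  then have "V (- t) - V t = V (- 0) - V 0" for t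
    using DERIV_isconst_all by blast
  then have evenV: "V \<bar>t\<bar> = V t" for t by (simp add: abs_if)
  show ?thesis
  proof (rule that[of V])
    show "continuous_on UNIV V"
      using V by (auto intro!: continuous_at_imp_continuous_on DERIV_isCont)
    show "V 0 \<le> V s" if "s \<ge> 0" for s by (rule V_ge[OF that])
    show "\<exists>L. h (cmod z) \<le> L \<and> has_laplacian (\<lambda>w. V (cmod w)) L z" for z
    proof (cases "z = 0")
      case True
      \<comment> \<open>At the origin each direction contributes \<open>h 0\<close>, and
        \<open>2 * h 0\<close> still dominates \<open>h 0\<close>.\<close>
      have "has_second_deriv V I (h 0)"
        unfolding has_second_deriv_def using V I by auto
      then have "has_laplacian (\<lambda>w. V (cmod w)) (h 0 + h 0) z"
        using True by (intro has_laplacianI) (auto simp: norm_mult evenV)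
      then show ?thesis using True nonneg[of 0] by (intro exI[of _ "h 0 + h 0"]) auto
    next
      case False
      define \<rho> where "\<rho> = cmod z"
      have \<rho>_pos: "\<rho> > 0" using False by (simp add: \<rho>_def)
      have \<rho>: "\<rho> = sqrt ((Re z)\<^sup>2 + (Im z)\<^sup>2)" "\<rho> = sqrt ((Im z)\<^sup>2 + (Re z)\<^sup>2)"
        by (simp_all add: \<rho>_def cmod_def add.commute)
      have ne: "Re z \<noteq> 0 \<or> Im z \<noteq> 0" "Im z \<noteq> 0 \<or> Re z \<noteq> 0" using False by (auto simp: complex_eq_iff)
      have 1: "cmod (z + of_real t) = sqrt ((Re z + t)\<^sup>2 + (Im z)\<^sup>2)"
        and 2: "cmod (z + \<i> * of_real t) = sqrt ((Im z + t)\<^sup>2 + (Re z)\<^sup>2)" for t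
        by (simp_all add: cmod_def add.commute)
      have "has_laplacian (\<lambda>w. V (cmod w))
         ((h \<rho> * ((Re z)\<^sup>2 / \<rho>\<^sup>2) + I \<rho> * (1 / \<rho> - (Re z)\<^sup>2 / \<rho> ^ 3)) +
          (h \<rho> * ((Im z)\<^sup>2 / \<rho>\<^sup>2) + I \<rho> * (1 / \<rho> - (Im z)\<^sup>2 / \<rho> ^ 3))) z"
        using has_second_deriv_radial[OF I(1) V ne(1)] has_second_deriv_radial[OF I(1) V ne(2)]
        unfolding \<rho>[symmetric] 1[symmetric] 2[symmetric]
        by (rule has_laplacianI) simp
      also have "(h \<rho> * ((Re z)\<^sup>2 / \<rho>\<^sup>2) + I \<rho> * (1 / \<rho> - (Re z)\<^sup>2 / \<rho> ^ 3)) +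
          (h \<rho> * ((Im z)\<^sup>2 / \<rho>\<^sup>2) + I \<rho> * (1 / \<rho> - (Im z)\<^sup>2 / \<rho> ^ 3))
          = h \<rho> * (((Re z)\<^sup>2 + (Im z)\<^sup>2) / \<rho>\<^sup>2) + I \<rho> * (2 / \<rho> - ((Re z)\<^sup>2 + (Im z)\<^sup>2) / \<rho> ^ 3)"
        by (simp add: algebra_simps add_divide_distrib)
      also have "(Re z)\<^sup>2 + (Im z)\<^sup>2 = \<rho>\<^sup>2" by (simp add: \<rho>_def cmod_power2)
      \<comment> \<open>This is the radial Laplacian \<open>V'' + V' / \<rho>\<close>, whose second
        term is nonnegative.\<close>
      also have "h \<rho> * (\<rho>\<^sup>2 / \<rho>\<^sup>2) + I \<rho> * (2 / \<rho> - \<rho>\<^sup>2 / \<rho> ^ 3) = h \<rho> + I \<rho> / \<rho>"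
        using \<rho>_pos by (simp add: field_simps power2_eq_square power3_eq_cube)
      finally show ?thesis
        using I_pos[of \<rho>] \<rho>_pos unfolding \<rho>_def by (intro exI[of _ "h \<rho> + I \<rho> / \<rho>"]) (auto simp: \<rho>_def)
    qed
    \<comment> \<open>In the derivative of the primitive \<open>(1 - s) * I s + V s\<close> the two
      terms \<open>I s\<close> cancel. At the endpoints \<open>I\<close> drops out, at 1 by its
      factor and at 0 by \<open>I 0 = 0\<close>.\<close>
    have "((\<lambda>s. (1 - s) * h s) has_integral (((1 - 1) * I 1 + V 1) - ((1 - 0) * I 0 + V 0))) {0..1}"
    proof (rule fundamental_theorem_of_calculus)
      fix s :: real
      have "((\<lambda>s. (1 - s) * I s + V s) has_real_derivative (1 - s) * h s) (at s within {0..1})"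
        using has_field_derivative_at_within[OF I(1)[of s]] has_field_derivative_at_within[OF V[of s]]
        by (auto intro!: derivative_eq_intros)
      then show "((\<lambda>s. (1 - s) * I s + V s) has_vector_derivative (1 - s) * h s) (at s within {0..1})"
        by (simp add: has_real_derivative_iff_has_vector_derivative)
    qed simp
    then show "((\<lambda>s. (1 - s) * h s) has_integral (V 1 - V 0)) {0..1}" using I(2) by simp
  qed
qed

section \<open>Dilated harmonic functions along coordinate lines, and their gradient\<close>

lemma has_real_derivative_line:
  assumes "u differentiable (at (of_real r * (z + v * of_real t)))"
  shows "((\<lambda>t. u (of_real r * (z + v * of_real t))) has_real_derivative
     r * partial_deriv v u (of_real r * (z + v * of_real t))) (at t)"
proof -
  define w where "w = of_real r * (z + v * of_real t)"
  have D: "(u has_derivative frechet_derivative u (at w)) (at w)"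
    using assms by (simp add: w_def frechet_derivative_works)
  have "((\<lambda>t. of_real r * (z + v * of_real t)) has_derivative (\<lambda>s. of_real r * (v * of_real s))) (at t)"
    by (auto intro!: derivative_eq_intros)
  then have "((\<lambda>t. u (of_real r * (z + v * of_real t))) has_derivative
      (\<lambda>s. frechet_derivative u (at w) (of_real r * (v * of_real s)))) (at t)"
    by (rule has_derivative_compose) (use D w_def in simp)
  also have "(\<lambda>s. frechet_derivative u (at w) (of_real r * (v * of_real s))) = (\<lambda>s. s * (r * partial_deriv v u w))"
  proof
    fix s :: real
    have "of_real r * (v * of_real s) = (r * s) *\<^sub>R v"
      by (simp add: scaleR_conv_of_real mult_ac)
    then show "frechet_derivative u (at w) (of_real r * (v * of_real s)) = s * (r * partial_deriv v u w)"
      using linear_scale[OF has_derivative_linear[OF D], of "r * s" v]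
      by (simp add: partial_deriv_def)
  qed
  finally show ?thesis unfolding w_def by (simp add: has_field_derivative_def mult_commute_abs)
qed

text \<open>The dilation is built in because the estimate concerns \<open>f\<close> on the circle of
  radius \<open>r\<close>, moved to the unit circle; each derivative along a line contributes one
  factor \<open>r\<close>.\<close>

lemma harmonic_on_line_second_deriv:
  assumes u: "harmonic_on u S" and S: "open S" and z: "of_real r * z \<in> S" and v: "v \<in> {1, \<i>}"
  shows "has_second_deriv (\<lambda>t. u (of_real r * (z + v * of_real t)))
     (\<lambda>t. r * partial_deriv v u (of_real r * (z + v * of_real t)))
     (r * (r * partial_deriv v (partial_deriv v u) (of_real r * z)))"
proof -
  have d: "u differentiable_on S" "partial_deriv v u differentiable_on S"
    using u v unfolding harmonic_on_def C2_on_def by auto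
  have d1: "u differentiable (at w)" and d2: "partial_deriv v u differentiable (at w)" if "w \<in> S" for w
    using d that S by (auto simp: differentiable_on_eq_differentiable_at)
  have "isCont (\<lambda>w. of_real r * w) z" by (intro continuous_intros)
  then have "\<forall>\<^sub>F w in nhds z. of_real r * w \<in> S"
    using tendsto_at_iff_tendsto_nhds[of "\<lambda>w. of_real r * w" z] topological_tendstoD[OF _ S z]
    by (simp add: isCont_def)
  then have "\<forall>\<^sub>F t::real in nhds 0. of_real r * (z + v * of_real t) \<in> S"
    by (rule eventually_nhds_line)
  then have "\<forall>\<^sub>F t in nhds 0. ((\<lambda>t. u (of_real r * (z + v * of_real t))) has_real_derivative
     r * partial_deriv v u (of_real r * (z + v * of_real t))) (at t)"
    by eventually_elim (rule has_real_derivative_line[OF d1])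
  moreover have "((\<lambda>t. r * partial_deriv v u (of_real r * (z + v * of_real t))) has_real_derivative
     r * (r * partial_deriv v (partial_deriv v u) (of_real r * z))) (at 0)"
    using has_real_derivative_line[OF d2, of r z v 0] z by (auto intro!: DERIV_cmult)
  ultimately show ?thesis unfolding has_second_deriv_def by blast
qed

lemma harmonic_on_has_laplacian:
  assumes u: "harmonic_on u S" and S: "open S" and z: "of_real r * z \<in> S"
  shows "has_laplacian (\<lambda>w. u (of_real r * w)) 0 z"
proof -
  have "r * (r * partial_x (partial_x u) (of_real r * z)) + r * (r * partial_y (partial_y u) (of_real r * z))
      = r * r * (partial_x (partial_x u) (of_real r * z) + partial_y (partial_y u) (of_real r * z))"
    by (simp add: algebra_simps)
  also have "\<dots> = 0" using u z by (simp add: harmonic_on_def)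
  finally show ?thesis
    using harmonic_on_line_second_deriv[OF u S z, of 1] harmonic_on_line_second_deriv[OF u S z, of \<i>]
    by (intro has_laplacianI) auto
qed

text \<open>Along a line the second derivative of \<open>(u - c)\<^sup>2\<close> is
  \<open>2 * u'\<^sup>2 + 2 * (u - c) * u''\<close>; the last terms of the two directions cancel by
  harmonicity.\<close>

lemma harmonic_on_has_laplacian_power2:
  assumes u: "harmonic_on u S" and S: "open S" and z: "of_real r * z \<in> S"
  shows "has_laplacian (\<lambda>w. (u (of_real r * w) - c)\<^sup>2)
     (2 * r\<^sup>2 * ((partial_x u (of_real r * z))\<^sup>2 + (partial_y u (of_real r * z))\<^sup>2)) z"
proof -
  define p where "p = (\<lambda>v. partial_deriv v u (of_real r * z))"
  define q where "q = (\<lambda>v. partial_deriv v (partial_deriv v u) (of_real r * z))"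
  define d where "d = u (of_real r * z) - c"
  have line: "has_second_deriv (\<lambda>t. (u (of_real r * (z + v * of_real t)) - c)\<^sup>2)
     (\<lambda>t. 2 * (u (of_real r * (z + v * of_real t)) + - c) * (r * partial_deriv v u (of_real r * (z + v * of_real t)) + 0))
     (2 * ((r * p v)\<^sup>2 + d * (r * (r * q v))))" if "v \<in> {1, \<i>}" for v
    using has_second_deriv_power2[OF has_second_deriv_add[OF harmonic_on_line_second_deriv[OF u S z that]
        has_second_deriv_const[of "- c"]]]
    by (simp add: p_def q_def d_def)
  have q0: "q 1 + q \<i> = 0" using u z by (simp add: harmonic_on_def q_def)
  have "2 * ((r * p 1)\<^sup>2 + d * (r * (r * q 1))) + 2 * ((r * p \<i>)\<^sup>2 + d * (r * (r * q \<i>)))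
     = 2 * r\<^sup>2 * ((p 1)\<^sup>2 + (p \<i>)\<^sup>2) + 2 * d * r * r * (q 1 + q \<i>)"
    by (simp add: algebra_simps power_mult_distrib)
  then have "2 * r\<^sup>2 * ((p 1)\<^sup>2 + (p \<i>)\<^sup>2)
     = 2 * ((r * p 1)\<^sup>2 + d * (r * (r * q 1))) + 2 * ((r * p \<i>)\<^sup>2 + d * (r * (r * q \<i>)))"
    using q0 by simp
  then show ?thesis
    using line[of 1] line[of \<i>] unfolding p_def by (intro has_laplacianI) auto
qed

text \<open>\<open>Lambda\<close> is built from derivatives of \<open>f\<close> itself, harmonicity
  from those of its real and imaginary parts; this connects the two.\<close>

lemma partial_deriv_Re_Im:
  assumes "(\<lambda>w. Re (f w)) differentiable (at z)" "(\<lambda>w. Im (f w)) differentiable (at z)"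
  shows "partial_deriv v f z = Complex (partial_deriv v (\<lambda>w. Re (f w)) z) (partial_deriv v (\<lambda>w. Im (f w)) z)"
proof -
  let ?A = "frechet_derivative (\<lambda>w. Re (f w)) (at z)" and ?B = "frechet_derivative (\<lambda>w. Im (f w)) (at z)"
  have "((\<lambda>w. of_real (Re (f w)) + \<i> * of_real (Im (f w))) has_derivative
      (\<lambda>x. of_real (?A x) + \<i> * of_real (?B x))) (at z)"
    using assms unfolding frechet_derivative_works
    by (intro has_derivative_add has_derivative_mult_right has_derivative_of_real)
  then have "(f has_derivative (\<lambda>x. of_real (?A x) + \<i> * of_real (?B x))) (at z)"
    by (simp add: complex_eq[symmetric])
  from frechet_derivative_at[OF this, symmetric] show ?thesis
    by (simp add: partial_deriv_def complex_eq_iff)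
qed

lemma cmod_add_square_parallelogram:
  "(cmod (a + b))\<^sup>2 + (cmod (a - b))\<^sup>2 = 2 * (cmod a)\<^sup>2 + 2 * (cmod b)\<^sup>2"
  unfolding cmod_power2 by (simp add: power2_eq_square algebra_simps)

text \<open>\<open>partial_x f\<close> is the sum of \<open>deriv_z f\<close> and
  \<open>deriv_zbar f\<close>, and \<open>partial_y f\<close> is \<open>\<i>\<close> times their
  difference, so the parallelogram law gives twice the sum of the squared moduli. The square of
  \<open>Lambda\<close> adds a nonnegative cross term.\<close>

lemma gradient_le_Lambda:
  assumes "(\<lambda>w. Re (f w)) differentiable (at z)" "(\<lambda>w. Im (f w)) differentiable (at z)"
  shows "(partial_x (\<lambda>w. Re (f w)) z)\<^sup>2 + (partial_y (\<lambda>w. Re (f w)) z)\<^sup>2 +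
    ((partial_x (\<lambda>w. Im (f w)) z)\<^sup>2 + (partial_y (\<lambda>w. Im (f w)) z)\<^sup>2) \<le> 2 * (Lambda f z)\<^sup>2"
proof -
  have "(partial_x (\<lambda>w. Re (f w)) z)\<^sup>2 + (partial_y (\<lambda>w. Re (f w)) z)\<^sup>2 +
    ((partial_x (\<lambda>w. Im (f w)) z)\<^sup>2 + (partial_y (\<lambda>w. Im (f w)) z)\<^sup>2)
     = (cmod (partial_x f z))\<^sup>2 + (cmod (partial_y f z))\<^sup>2"
    by (simp add: partial_deriv_Re_Im[OF assms] cmod_power2)
  also have "partial_x f z = deriv_z f z + deriv_zbar f z"
    by (simp add: deriv_z_def deriv_zbar_def field_simps)
  also have "cmod (partial_y f z) = cmod (\<i> * (deriv_z f z - deriv_zbar f z))"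
    by (simp add: deriv_z_def deriv_zbar_def diff_divide_distrib[symmetric] norm_mult norm_divide)
  also have "\<dots> = cmod (deriv_z f z - deriv_zbar f z)" by (simp add: norm_mult)
  also have "(cmod (deriv_z f z + deriv_zbar f z))\<^sup>2 + (cmod (deriv_z f z - deriv_zbar f z))\<^sup>2
    = 2 * (cmod (deriv_z f z))\<^sup>2 + 2 * (cmod (deriv_zbar f z))\<^sup>2"
    by (rule cmod_add_square_parallelogram)
  also have "\<dots> \<le> 2 * (Lambda f z)\<^sup>2"
    by (simp add: Lambda_def power2_sum)
  finally show ?thesis .
qed

section \<open>The norm estimate\<close>

text \<open>The quotient \<open>\<omega> t / t\<close> is compared with its value at 1; this is the
  origin of the constant \<open>\<omega> 1\<close> in the final bound.\<close>

lemma majorant_le_linear: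
  assumes "majorant \<omega>" "t \<ge> 1"
  shows "\<omega> t \<le> \<omega> 1 * t"
proof -
  have "\<omega> t / t \<le> \<omega> 1 / 1"
    using assms by (intro monotone_onD[of "{0<..}" "(\<le>)" "(\<ge>)" "\<lambda>t. \<omega> t / t"]) (auto simp: majorant_def)
  then show ?thesis using assms by (simp add: divide_le_eq)
qed

lemma majorant_nonneg: "majorant \<omega> \<Longrightarrow> t \<ge> 0 \<Longrightarrow> \<omega> t \<ge> 0"
  unfolding majorant_def by auto

lemma continuous_on_majorant_compose:
  assumes "majorant \<omega>" "continuous_on A g" "\<And>x. x \<in> A \<Longrightarrow> g x \<ge> 0"
  shows "continuous_on A (\<lambda>x. \<omega> (g x))"
  by (rule continuous_on_compose2[of "{0..}" \<omega>]) (use assms in \<open>auto simp: majorant_def\<close>)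

lemma harmonic_on_differentiable:
  assumes "harmonic_on u S" "open S" "z \<in> S"
  shows "u differentiable (at z)"
  using assms by (auto simp: harmonic_on_def C2_on_def differentiable_on_eq_differentiable_at)

lemma harmonic_mapping_on_continuous_on:
  assumes "harmonic_mapping_on f S" shows "continuous_on S f"
proof -
  have "continuous_on S (\<lambda>z. Re (f z))" "continuous_on S (\<lambda>z. Im (f z))"
    using assms unfolding harmonic_mapping_on_def harmonic_on_def C2_on_def
    by (auto intro: differentiable_imp_continuous_on)
  then have "continuous_on S (\<lambda>z. of_real (Re (f z)) + \<i> * of_real (Im (f z)))"
    by (intro continuous_on_add continuous_on_mult_left continuous_on_of_real)
  then show ?thesis by (simp add: complex_eq[symmetric])
qed

lemma set_lebesgue_integral_continuous:
  fixes g :: "real \<Rightarrow> 'a::euclidean_space"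
  assumes "continuous_on {a..b} g"
  shows "(LINT \<theta>:{a..b}|lebesgue. g \<theta>) = integral {a..b} g"
  by (rule set_lebesgue_integral_eq_integral(2)) (rule absolutely_integrable_continuous_real[OF assms])

text \<open>Both \<open>u\<close> and \<open>- u\<close> are superharmonic, which gives the two
  inequalities.\<close>

lemma poisson_integral_harmonic:
  assumes u: "continuous_on (cball 0 1) u"
    and lap: "\<And>z. z \<in> ball 0 1 \<Longrightarrow> has_laplacian u 0 z"
    and z: "z \<in> ball 0 1"
  shows "poisson_integral u z = u z"
proof (rule antisym)
  show "poisson_integral u z \<le> u z"
    by (rule poisson_integral_le_superharmonic[OF u _ z]) (use lap in blast)
  have "poisson_integral (\<lambda>w. - u w) z \<le> - u z"
    by (rule poisson_integral_le_superharmonic[OF continuous_on_minus[OF u] _ z])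
      (use has_laplacian_minus[OF lap] in fastforce)
  then show "u z \<le> poisson_integral u z" by (simp add: poisson_integral_minus)
qed

section \<open>Reduction of the norm to real Poisson integrals\<close>

lemma poisson_extension_eq:
  assumes g: "continuous_on (sphere 0 1) g" and z: "z \<in> ball 0 1"
  shows "poisson_extension (\<lambda>\<theta>. g (cis \<theta>)) z =
    Complex (poisson_integral (\<lambda>w. Re (g w)) z) (poisson_integral (\<lambda>w. Im (g w)) z)"
proof -
  have c: "continuous_on {0..2*pi} (\<lambda>\<theta>. poisson_kernel (cis \<theta>) z *\<^sub>R g (cis \<theta>))"
    using z by (intro continuous_intros continuous_on_poisson_kernel continuous_on_circle_param[OF g]) auto
  have i: "(\<lambda>\<theta>. poisson_kernel (cis \<theta>) z *\<^sub>R g (cis \<theta>)) integrable_on {0..2*pi}"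
    by (rule integrable_continuous_real[OF c])
  have "poisson_extension (\<lambda>\<theta>. g (cis \<theta>)) z
      = (1 / (2 * pi)) *\<^sub>R integral {0..2*pi} (\<lambda>\<theta>. poisson_kernel (cis \<theta>) z *\<^sub>R g (cis \<theta>))"
    unfolding poisson_extension_def set_lebesgue_integral_continuous[OF c] ..
  then show ?thesis
    using has_integral_Re[OF integrable_integral[OF i]] has_integral_Im[OF integrable_integral[OF i]]
    by (simp add: complex_eq_iff poisson_integral_def integral_unique)
qed

text \<open>Outside this space the norm is infinite by definition, so membership has to precede any
  finite bound.\<close>

lemma periodic_L2_circle:
  assumes g: "continuous_on (sphere 0 1) g"
  shows "(\<lambda>\<theta>. g (cis \<theta>)) \<in> periodic_L2"
proof -
  have c: "continuous_on {0..2*pi} (\<lambda>\<theta>. g (cis \<theta>))"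
    by (rule continuous_on_circle_param[OF g])
  then have "set_integrable lebesgue {0..2*pi} (\<lambda>\<theta>. g (cis \<theta>))"
    by (rule absolutely_integrable_continuous_real)
  then have "set_borel_measurable lebesgue {0..2*pi} (\<lambda>\<theta>. g (cis \<theta>))"
    unfolding set_integrable_def set_borel_measurable_def by (rule borel_measurable_integrable)
  moreover have "set_integrable lebesgue {0..2*pi} (\<lambda>\<theta>. (cmod (g (cis \<theta>)))\<^sup>2)"
    by (intro absolutely_integrable_continuous_real continuous_intros c)
  moreover have "cis (\<theta> + 2 * pi) = cis \<theta>" for \<theta>
    by (simp add: cis_mult[symmetric])
  ultimately show ?thesis by (simp add: periodic_L2_def)
qed

text \<open>This leaves a bound uniform in \<open>z\<close> on Poisson integrals; continuity allows
  the Lebesgue integrals to be read as gauge integrals.\<close>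

lemma bmo_h_norm_le:
  assumes g: "continuous_on (sphere 0 1) g"
    and ext: "\<And>z. z \<in> ball 0 1 \<Longrightarrow> poisson_extension (\<lambda>\<theta>. g (cis \<theta>)) z = G z"
    and le: "\<And>z. z \<in> ball 0 1 \<Longrightarrow> poisson_integral (\<lambda>w. (cmod (g w - G z))\<^sup>2) z \<le> B"
  shows "bmo_h_norm (\<lambda>\<theta>. g (cis \<theta>)) \<le> ennreal (sqrt B)"
proof -
  have "sqrt (1 / (2 * pi) * (LINT \<theta>:{0..2*pi}|lebesgue.
     (cmod (g (cis \<theta>) - poisson_extension (\<lambda>\<theta>. g (cis \<theta>)) z))\<^sup>2 * poisson_kernel (cis \<theta>) z)) \<le> sqrt B"
    if z: "z \<in> ball 0 1" for z
  proof -
    have c: "continuous_on {0..2*pi} (\<lambda>\<theta>. (cmod (g (cis \<theta>) - G z))\<^sup>2 * poisson_kernel (cis \<theta>) z)"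
      using z by (intro continuous_intros continuous_on_poisson_kernel continuous_on_circle_param[OF g]) auto
    have "1 / (2 * pi) * (LINT \<theta>:{0..2*pi}|lebesgue. (cmod (g (cis \<theta>) - G z))\<^sup>2 * poisson_kernel (cis \<theta>) z)
        = poisson_integral (\<lambda>w. (cmod (g w - G z))\<^sup>2) z"
      unfolding set_lebesgue_integral_continuous[OF c] poisson_integral_def by (simp add: mult.commute)
    then show ?thesis using le[OF z] unfolding ext[OF z] by simp
  qed
  then show ?thesis
    using periodic_L2_circle[OF g] unfolding bmo_h_norm_def
    by (auto intro!: SUP_least ennreal_leI)
qed

theorem theorem6:
  fixes \<omega> :: "real \<Rightarrow> real" and M r :: real and f :: "complex \<Rightarrow> complex"
  assumes "majorant \<omega>"
    and "M > 0"
    and "harmonic_mapping_on f (ball 0 1)"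
    and "\<And>z. z \<in> ball 0 1 \<Longrightarrow> Lambda f z \<le> M * \<omega> (1 / (1 - cmod z))"
    and "0 < r" and "r < 1"
  shows "bmo_h_norm (\<lambda>\<theta>. f (of_real r * cis \<theta>))
    \<le> ennreal (2 * sqrt (\<omega> 1) * M * r *
        sqrt (LINT t:{0..1}|lebesgue. \<omega> (1 / (1 - r * t))))"
proof -
  note \<omega> = \<open>majorant \<omega>\<close>
  have harm: "harmonic_on (\<lambda>z. Re (f z)) (ball 0 1)" "harmonic_on (\<lambda>z. Im (f z)) (ball 0 1)"
    using assms(3) by (auto simp: harmonic_mapping_on_def)
  \<comment> \<open>Since \<open>r < 1\<close>, the dilated mapping is continuous up to the unit
    circle, where it takes the values of the given boundary function.\<close>
  define F where "F = (\<lambda>z. f (of_real r * z))"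
  have rz: "of_real r * z \<in> ball 0 1" if "z \<in> cball 0 1" for z :: complex
  proof -
    have "r * cmod z \<le> r" using that assms(5) by (simp add: mult_left_le)
    then have "r * cmod z < 1" using assms(6) by linarith
    then show ?thesis using assms(5) by (simp add: norm_mult)
  qed
  have F: "continuous_on (cball 0 1) F"
    unfolding F_def
    by (rule continuous_on_compose2[OF harmonic_mapping_on_continuous_on[OF assms(3)]])
      (use rz in \<open>auto intro!: continuous_intros\<close>)
  \<comment> \<open>The 4 is the 2 from the Laplacian of a square times the 2 from
    \<open>gradient_le_Lambda\<close>.\<close>
  define C where "C = 4 * r\<^sup>2 * M\<^sup>2 * \<omega> 1"
  have C: "C \<ge> 0" using majorant_nonneg[OF \<omega>, of 1] by (simp add: C_def)
  \<comment> \<open>Clamping \<open>|s|\<close> at 1 makes \<open>h\<close> continuous, even and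
    nonnegative on the whole line, as \<open>radial_subsolution\<close> demands; on
    \<open>[0, 1]\<close> the clamp has no effect.\<close>
  define h where "h = (\<lambda>s. C * (\<omega> (1 / (1 - r * min \<bar>s\<bar> 1)) / (1 - r * min \<bar>s\<bar> 1)))"
  have pos: "1 - r * min \<bar>s\<bar> 1 > 0" for s
  proof -
    have "r * min \<bar>s\<bar> 1 \<le> r * 1" using assms(5) by (intro mult_left_mono) auto
    then show ?thesis using assms(6) by linarith
  qed
  have cont_T: "continuous_on UNIV (\<lambda>s. 1 / (1 - r * min \<bar>s\<bar> 1))"
    by (intro continuous_intros) (use pos in \<open>auto dest: less_imp_neq\<close>)
  have cont_W: "continuous_on UNIV (\<lambda>s. \<omega> (1 / (1 - r * min \<bar>s\<bar> 1)))"
    by (rule continuous_on_majorant_compose[OF \<omega> cont_T]) (use pos in \<open>simp add: less_imp_le\<close>)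
  have "h = (\<lambda>s. C * (\<omega> (1 / (1 - r * min \<bar>s\<bar> 1)) * (1 / (1 - r * min \<bar>s\<bar> 1))))"
    by (simp add: h_def)
  then have "continuous_on UNIV h"
    by (simp only:) (intro continuous_on_mult continuous_on_const cont_T cont_W)
  moreover have "h s \<ge> 0" for s
    unfolding h_def using C pos[of s] majorant_nonneg[OF \<omega>] by (simp add: less_imp_le)
  moreover have "h (- s) = h s" for s by (simp add: h_def)
  ultimately obtain V where V: "continuous_on UNIV V" "\<And>s. s \<ge> 0 \<Longrightarrow> V 0 \<le> V s"
    "\<And>z. \<exists>L. h (cmod z) \<le> L \<and> has_laplacian (\<lambda>w. V (cmod w)) L z"
    "((\<lambda>s. (1 - s) * h s) has_integral (V 1 - V 0)) {0..1}"
    using radial_subsolution by blast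

  define W where "W = (\<lambda>t. \<omega> (1 / (1 - r * t)))"
  have W: "continuous_on {0..1} W"
    by (rule continuous_on_eq[OF continuous_on_subset[OF cont_W]]) (auto simp: W_def)
  have "((\<lambda>t. C * W t) has_integral C * integral {0..1} W) {0..1}"
    using integrable_integral[OF integrable_continuous_real[OF W]] by (rule has_integral_mult_right)
  with V(4) have V_bound: "V 1 - V 0 \<le> C * integral {0..1} W"
  proof (rule has_integral_le)
    fix s :: real assume s: "s \<in> {0..1}"
    have "1 - r * s > 0" using pos[of s] s by simp
    moreover have "1 - s \<le> 1 - r * s" using s assms(6) mult_right_mono[of r 1 s] by simp
    ultimately have "(1 - s) / (1 - r * s) \<le> 1" by simp
    moreover have "C * W s \<ge> 0" using C majorant_nonneg[OF \<omega>] \<open>1 - r * s > 0\<close> by (simp add: W_def)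
    ultimately have "C * W s * ((1 - s) / (1 - r * s)) \<le> C * W s" by (rule mult_left_le)
    then show "(1 - s) * h s \<le> C * W s" using s by (simp add: h_def W_def mult_ac)
  qed

  have dist_sq: "\<exists>L\<le>h (cmod z). has_laplacian (\<lambda>w. (cmod (F w - c))\<^sup>2) L z" if z: "z \<in> ball 0 1" for c z
  proof -
    define w where "w = of_real r * z"
    have w: "w \<in> ball 0 1" using rz z by (auto simp: w_def)
    have cw: "cmod w = r * cmod z" using assms(5) by (simp add: w_def norm_mult)
    define T where "T = 1 / (1 - cmod w)"
    have T: "T \<ge> 1" using w by (simp add: T_def)
    define L where "L = 2 * r\<^sup>2 * ((partial_x (\<lambda>w. Re (f w)) w)\<^sup>2 + (partial_y (\<lambda>w. Re (f w)) w)\<^sup>2)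
      + 2 * r\<^sup>2 * ((partial_x (\<lambda>w. Im (f w)) w)\<^sup>2 + (partial_y (\<lambda>w. Im (f w)) w)\<^sup>2)"
    have "has_laplacian (\<lambda>w. (Re (F w) - Re c)\<^sup>2 + (Im (F w) - Im c)\<^sup>2) L z"
      using w unfolding F_def L_def w_def
      by (intro has_laplacian_add harmonic_on_has_laplacian_power2[OF harm(1)]
          harmonic_on_has_laplacian_power2[OF harm(2)] open_ball)
    then have "has_laplacian (\<lambda>w. (cmod (F w - c))\<^sup>2) L z" by (simp add: cmod_power2)
    moreover have "L \<le> h (cmod z)"
    proof -
      have "L = 2 * r\<^sup>2 * (((partial_x (\<lambda>w. Re (f w)) w)\<^sup>2 + (partial_y (\<lambda>w. Re (f w)) w)\<^sup>2)
        + ((partial_x (\<lambda>w. Im (f w)) w)\<^sup>2 + (partial_y (\<lambda>w. Im (f w)) w)\<^sup>2))"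
        unfolding L_def by (simp only: distrib_left)
      also have "\<dots> \<le> 2 * r\<^sup>2 * (2 * (Lambda f w)\<^sup>2)"
        by (intro mult_left_mono gradient_le_Lambda harmonic_on_differentiable[OF harm(1) open_ball w]
            harmonic_on_differentiable[OF harm(2) open_ball w]) simp
      also have "(Lambda f w)\<^sup>2 \<le> (M * \<omega> T)\<^sup>2"
        using assms(4)[OF w] by (intro power_mono) (auto simp: T_def Lambda_def)
      also have "(M * \<omega> T)\<^sup>2 = M\<^sup>2 * (\<omega> T * \<omega> T)" by (simp add: power_mult_distrib power2_eq_square)
      \<comment> \<open>Only one of the two factors \<open>\<omega> T\<close> is replaced by its
        linear bound; the other survives and becomes the integrand of the final bound.\<close>
      also have "\<omega> T * \<omega> T \<le> (\<omega> 1 * T) * \<omega> T"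
        using majorant_le_linear[OF \<omega> T] majorant_nonneg[OF \<omega>, of T] T by (intro mult_right_mono) auto
      also have "2 * r\<^sup>2 * (2 * (M\<^sup>2 * (\<omega> 1 * T * \<omega> T))) = C * (\<omega> T * T)"
        by (simp add: C_def)
      also have "\<dots> = h (cmod z)"
        using z by (simp add: h_def T_def cw)
      finally show ?thesis by (simp add: mult_left_mono)
    qed
    ultimately show ?thesis by blast
  qed

  have "bmo_h_norm (\<lambda>\<theta>. F (cis \<theta>)) \<le> ennreal (sqrt (C * integral {0..1} W))"
  proof (rule bmo_h_norm_le)
    show Fs: "continuous_on (sphere 0 1) F" using F by (rule continuous_on_subset) auto
    fix z :: complex assume z: "z \<in> ball 0 1"
    have "poisson_integral (\<lambda>w. Re (F w)) z = Re (F z)"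
      by (rule poisson_integral_harmonic[OF continuous_on_Re[OF F] _ z])
        (use harmonic_on_has_laplacian[OF harm(1) open_ball] rz in \<open>simp add: F_def\<close>)
    moreover have "poisson_integral (\<lambda>w. Im (F w)) z = Im (F z)"
      by (rule poisson_integral_harmonic[OF continuous_on_Im[OF F] _ z])
        (use harmonic_on_has_laplacian[OF harm(2) open_ball] rz in \<open>simp add: F_def\<close>)
    ultimately show "poisson_extension (\<lambda>\<theta>. F (cis \<theta>)) z = F z"
      by (simp add: poisson_extension_eq[OF Fs z])
    define u where "u = (\<lambda>w. (cmod (F w - F z))\<^sup>2)"
    have u: "continuous_on (cball 0 1) u" unfolding u_def by (intro continuous_intros F)
    have V': "continuous_on A (\<lambda>w. V (cmod w))" for A :: "complex set"
      by (rule continuous_on_compose2[OF V(1)]) (auto intro!: continuous_intros)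
    have "poisson_integral (\<lambda>w. u w - V (cmod w)) z \<le> u z - V (cmod z)"
    proof (rule poisson_integral_le_superharmonic[OF _ _ z])
      show "continuous_on (cball 0 1) (\<lambda>w. u w - V (cmod w))" by (intro continuous_intros u V')
      fix x :: complex assume x: "x \<in> ball 0 1"
      obtain K L where "K \<le> h (cmod x)" "has_laplacian u K x" "h (cmod x) \<le> L" "has_laplacian (\<lambda>w. V (cmod w)) L x"
        using dist_sq[OF x, of "F z"] V(3)[of x] unfolding u_def by blast
      then show "\<exists>L\<le>0. has_laplacian (\<lambda>w. u w - V (cmod w)) L x"
        by (intro exI[of _ "K - L"] conjI has_laplacian_diff) auto
    qed
    moreover have "poisson_integral (\<lambda>w. u w - V (cmod w)) z = poisson_integral u z - V 1"
    proof -
      have "poisson_integral (\<lambda>w. u w - V (cmod w)) z = poisson_integral u z - poisson_integral (\<lambda>w. V (cmod w)) z"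
        using z by (intro poisson_integral_diff V' continuous_on_subset[OF u]) auto
      \<comment> \<open>On the circle the radial function is constantly \<open>V 1\<close>.\<close>
      also have "poisson_integral (\<lambda>w. V (cmod w)) z = poisson_integral (\<lambda>w. V 1) z"
        by (rule poisson_integral_cong) simp
      finally show ?thesis using z by (simp add: poisson_integral_const)
    qed
    \<comment> \<open>As \<open>u z = 0\<close>, the two facts bound the integral by
      \<open>V 1 - V (cmod z)\<close>, and \<open>V 0 \<le> V (cmod z)\<close>.\<close>
    ultimately show "poisson_integral (\<lambda>w. (cmod (F w - F z))\<^sup>2) z \<le> C * integral {0..1} W"
      using V_bound V(2)[of "cmod z"] by (simp add: u_def)
  qed
  \<comment> \<open>Positivity of \<open>M\<close> and \<open>r\<close> gives
    \<open>sqrt C = 2 * r * M * sqrt (\<omega> 1)\<close> without absolute values.\<close>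
  also have "sqrt (C * integral {0..1} W) = 2 * sqrt (\<omega> 1) * M * r * sqrt (LINT t:{0..1}|lebesgue. W t)"
    using assms(2,5) by (simp add: set_lebesgue_integral_continuous[OF W] C_def real_sqrt_mult)
  finally show ?thesis by (simp add: F_def W_def)
qed

end
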